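(* Let $m$, $t$ and $r\geq 4$ be integers satisfying $${t-1\choose r}\leq m \leq {t-1\choose r}+ {t-2\choose r-1}-\big[(2r-6)\cdot 2^{r-1}+2^{r-3}+(r-4)(2r-7)-1\big]\Big({t-2\choose r-2}-1\Big).$$ Let $G$ be an $r$-uniform hypergraph with $t$ vertices and $m$ edges that does not contain a clique of order $t-1$. Then $\lambda(G) < \lambda([t-1]^{(r)})$.
   Context: An $r$-uniform hypergraph ($r$-graph) $G$ consists of a vertex set $V(G)$ and an edge set $E(G)\subseteq V(G)^{(r)}$, where $V^{(r)}$ denotes the family of all $r$-element subsets of $V$. A clique of order $s$ in $G$ is a set of $s$ vertices all of whose $r$-subsets are edges of $G$. For $n\in\mathbb N$, $[n]=\{1,\dots,n\}$ and $[n]^{(r)}$ denotes the complete $r$-graph on vertex set $[n]$. For an $r$-graph $G$ on vertex set $[n]$ and $\vec x=(x_1,\dots,x_n)\in\mathbb R^n$, let $\lambda(G,\vec x)=\sum_{i_1\cdots i_r\in E(G)}x_{i_1}\cdots x_{i_r}$. The Lagrangian of $G$ is $\lambda(G)=\max\{\lambda(G,\vec x): \vec x\in S\}$, where $S=\{\vec x\in\mathbb R^n:\sum_i x_i=1,\ x_i\geq 0\}$. *)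

theory Defs
  imports "HOL-Analysis.Analysis" "HOL-Library.Ramsey"
begin

text \<open>
  The family of all \<open>r\<close>-element subsets of \<open>V\<close> is \<^term>\<open>[V]\<^bsup>r\<^esup>\<close>, i.e. \<^const>\<open>nsets\<close>.
\<close>

definition r_graph :: "nat \<Rightarrow> 'a set \<Rightarrow> 'a set set \<Rightarrow> bool" where
  "r_graph r V E \<longleftrightarrow> finite V \<and> E \<subseteq> [V]\<^bsup>r\<^esup>"

definition is_clique :: "nat \<Rightarrow> 'a set \<Rightarrow> 'a set set \<Rightarrow> 'a set \<Rightarrow> bool" where
  "is_clique r V E K \<longleftrightarrow> K \<subseteq> V \<and> [K]\<^bsup>r\<^esup> \<subseteq> E"

definition has_clique :: "nat \<Rightarrow> 'a set \<Rightarrow> 'a set set \<Rightarrow> nat \<Rightarrow> bool" where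
  "has_clique r V E s \<longleftrightarrow> (\<exists>K. is_clique r V E K \<and> card K = s)"

definition lagrange_poly :: "'a set set \<Rightarrow> ('a \<Rightarrow> real) \<Rightarrow> real" where
  "lagrange_poly E x = (\<Sum>e\<in>E. \<Prod>i\<in>e. x i)"

text \<open>
  Vectors in \<open>\<real>\<^sup>V\<close> are total functions; their values outside \<open>V\<close> are unconstrained, and
  irrelevant because the edges are subsets of \<open>V\<close>.
\<close>

definition weight_simplex :: "'a set \<Rightarrow> ('a \<Rightarrow> real) set" where
  "weight_simplex V = {x. (\<forall>i\<in>V. 0 \<le> x i) \<and> (\<Sum>i\<in>V. x i) = 1}"

text \<open>For finite nonempty \<open>V\<close> the supremum is a maximum, see \<open>lagrangian_attained\<close> below.\<close>

definition lagrangian :: "'a set \<Rightarrow> 'a set set \<Rightarrow> real" where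
  "lagrangian V E = (SUP x\<in>weight_simplex V. lagrange_poly E x)"

lemma lagrangian_attained:
  assumes G: "r_graph r V E" and ne: "V \<noteq> {}"
  shows "\<exists>x\<in>weight_simplex V. lagrangian V E = lagrange_poly E x
           \<and> (\<forall>y\<in>weight_simplex V. lagrange_poly E y \<le> lagrange_poly E x)"
proof -
  have fin: "finite V" and E: "\<And>e. e \<in> E \<Longrightarrow> e \<subseteq> V"
    using G by (auto simp: r_graph_def nsets_def)
  define B where "B = PiE UNIV (\<lambda>i. if i \<in> V then {0..1::real} else {0})"
  define S where "S = B \<inter> {x. (\<Sum>i\<in>V. x i) = 1}"
  have "compactin (product_topology (\<lambda>_. euclidean) UNIV) B"
    unfolding B_def compactin_PiE by auto
  then have "compact B"
    by (simp add: euclidean_product_topology)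
  moreover have cproj: "continuous_on A (\<lambda>x::'a \<Rightarrow> real. x i)" for A i
    by (rule continuous_on_subset[OF continuous_on_product_coordinates]) simp
  have "closed {x::'a \<Rightarrow> real. (\<Sum>i\<in>V. x i) = 1}"
    by (intro closed_Collect_eq continuous_on_sum cproj continuous_on_const)
  ultimately have cS: "compact S"
    unfolding S_def by (intro compact_Int_closed)
  have cont: "continuous_on S (lagrange_poly E)"
    unfolding lagrange_poly_def
    by (intro continuous_on_sum continuous_on_prod cproj)
  define cut where "cut x = (\<lambda>i. if i \<in> V then x i else (0::real))" for x
  have cut_S: "cut x \<in> S" if "x \<in> weight_simplex V" for x
  proof -
    have "x i \<le> 1" if "i \<in> V" for i
      using member_le_sum[OF that, of x] \<open>x \<in> weight_simplex V\<close> fin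
      by (auto simp: weight_simplex_def)
    then show ?thesis
      using that by (auto simp: S_def B_def cut_def weight_simplex_def)
  qed
  have cut_poly: "lagrange_poly E (cut x) = lagrange_poly E x" for x
    unfolding lagrange_poly_def cut_def
    by (intro sum.cong prod.cong refl) (use E in auto)
  have S_sub: "S \<subseteq> weight_simplex V"
  proof
    fix x assume x: "x \<in> S"
    have "x i \<in> (if i \<in> V then {0..1} else {0})" for i
      using x by (auto simp only: S_def B_def PiE_iff)
    then have "0 \<le> x i" if "i \<in> V" for i
      using that by (metis atLeastAtMost_iff)
    then show "x \<in> weight_simplex V"
      using x by (simp add: S_def weight_simplex_def)
  qed
  obtain v where v: "v \<in> V" using ne by blast
  have "(\<lambda>i. if i = v then 1 else 0) \<in> weight_simplex V"
    using v fin by (auto simp: weight_simplex_def)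
  then have "S \<noteq> {}" using cut_S by blast
  then obtain x where x: "x \<in> S" "\<And>y. y \<in> S \<Longrightarrow> lagrange_poly E y \<le> lagrange_poly E x"
    using continuous_attains_sup[OF cS _ cont] by blast
  have max: "lagrange_poly E y \<le> lagrange_poly E x" if "y \<in> weight_simplex V" for y
    using x(2)[OF cut_S[OF that]] by (simp add: cut_poly)
  have "lagrangian V E = lagrange_poly E x"
    unfolding lagrangian_def
    by (rule cSup_eq_maximum) (use x(1) S_sub max in auto)
  then show ?thesis
    using x(1) S_sub max by blast
qed

end

theory Submission imports Defs begin

text \<open>
  By Maclaurin's inequality \<open>\<lambda>([t-1]\<^sup>(\<^sup>r\<^sup>)) = L\<close> with \<open>L = (t-1 choose r) / (t-1)\<^sup>r\<close>. Let \<open>x\<close> be an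
  optimal weighting of \<open>G\<close>. If some weight vanishes, \<open>G\<close> lives on \<open>t - 1\<close> vertices that do not form
  a clique, and \<open>\<lambda>(G) < L\<close>. Otherwise suppose \<open>\<lambda>(G) \<ge> L\<close>. The Lagrange condition at \<open>v\<close> says
  that the link of \<open>v\<close> has value \<open>r \<lambda>(G)\<close>; bounding the link by Maclaurin's inequality gives
  \<open>x\<^sub>v \<le> u = 1 / (t - r)\<close>. Since the weights sum to \<open>1\<close>, their total deficit from \<open>u\<close> is \<open>r u\<close>, so
  fewer than \<open>2 r\<close> vertices have weight below \<open>u / 2\<close>. Let \<open>a\<close> and \<open>b\<close> be the two lightest vertices.
  Merging them turns the complete \<open>r\<close>-graph on \<open>V\<close> into one on \<open>t - 1\<close> vertices and
  loses at most \<open>x\<^sub>a x\<^sub>b (t-2 choose r-2) u\<^sup>r\<^sup>-\<^sup>2\<close>. But each non-edge with at most two vertices of weight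
  below \<open>u / 2\<close> weighs at least \<open>x\<^sub>a x\<^sub>b (u / 2)\<^sup>r\<^sup>-\<^sup>2\<close>, and the upper bound on \<open>m\<close> leaves more than
  \<open>2\<^sup>r\<^sup>-\<^sup>2 (t-2 choose r-2)\<close> of them. Hence \<open>\<lambda>(G) < L\<close> after all.
\<close>

section \<open>Complete r-graphs and Maclaurin's inequality\<close>

lemma nsets_insert_Suc:
  assumes "v \<notin> W"
  shows "[insert v W]\<^bsup>Suc k\<^esup> = [W]\<^bsup>Suc k\<^esup> \<union> insert v ` [W]\<^bsup>k\<^esup>"
proof (intro equalityI subsetI)
  fix e assume e: "e \<in> [insert v W]\<^bsup>Suc k\<^esup>"
  show "e \<in> [W]\<^bsup>Suc k\<^esup> \<union> insert v ` [W]\<^bsup>k\<^esup>"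
  proof (cases "v \<in> e")
    case True
    then have "e = insert v (e - {v})" by blast
    moreover have "e - {v} \<in> [W]\<^bsup>k\<^esup>"
      using e True by (auto simp: nsets_def)
    ultimately show ?thesis by blast
  qed (use e in \<open>auto simp: nsets_def\<close>)
next
  fix e assume "e \<in> [W]\<^bsup>Suc k\<^esup> \<union> insert v ` [W]\<^bsup>k\<^esup>"
  then show "e \<in> [insert v W]\<^bsup>Suc k\<^esup>"
    using assms by (auto simp: nsets_def card_insert_if)
qed

lemma lagrange_poly_nsets_insert:
  assumes "finite W" "v \<notin> W"
  shows "lagrange_poly ([insert v W]\<^bsup>Suc k\<^esup>) x
    = lagrange_poly ([W]\<^bsup>Suc k\<^esup>) x + x v * lagrange_poly ([W]\<^bsup>k\<^esup>) x"
proof -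
  have notin: "v \<notin> e" "finite e" if "e \<in> [W]\<^bsup>k\<^esup>" for e k
    using that assms by (auto simp: nsets_def)
  have inj: "inj_on (insert v) ([W]\<^bsup>k\<^esup>)"
    by (rule inj_onI) (metis notin(1) insert_ident)
  have "lagrange_poly ([insert v W]\<^bsup>Suc k\<^esup>) x
      = lagrange_poly ([W]\<^bsup>Suc k\<^esup>) x + lagrange_poly (insert v ` [W]\<^bsup>k\<^esup>) x"
    unfolding lagrange_poly_def nsets_insert_Suc[OF assms(2)]
    by (rule sum.union_disjoint) (use assms notin in \<open>auto simp: finite_imp_finite_nsets\<close>)
  also have "lagrange_poly (insert v ` [W]\<^bsup>k\<^esup>) x = x v * lagrange_poly ([W]\<^bsup>k\<^esup>) x"
    unfolding lagrange_poly_def sum.reindex[OF inj] sum_distrib_left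
    by (rule sum.cong) (use notin in auto)
  finally show ?thesis .
qed

text \<open>Convexity of a power, by induction: \<open>p\<close> times one tangent line exceeds the
  next tangent line by the nonnegative term \<open>(k + 1) q^k (p - q)^2\<close>.\<close>

lemma power_Suc_ge_tangent:
  fixes p q :: real
  assumes "0 \<le> p" "0 \<le> q"
  shows "q ^ Suc k + real (Suc k) * q ^ k * (p - q) \<le> p ^ Suc k"
proof (induction k)
  case (Suc k)
  have "p * (q ^ Suc k + real (Suc k) * q ^ k * (p - q))
      - (q ^ Suc (Suc k) + real (Suc (Suc k)) * q ^ Suc k * (p - q))
      = real (Suc k) * q ^ k * (p - q)\<^sup>2"
    by (simp add: algebra_simps power2_eq_square)
  moreover have "0 \<le> real (Suc k) * q ^ k * (p - q)\<^sup>2"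
    using assms by simp
  moreover have "p * (q ^ Suc k + real (Suc k) * q ^ k * (p - q)) \<le> p * p ^ Suc k"
    using Suc assms(1) by (rule mult_left_mono)
  ultimately show ?case by simp
qed simp

text \<open>Maclaurin's inequality. Adding a vertex replaces the mean \<open>q\<close> by \<open>p\<close>, and the induction
  step is exactly the tangent inequality for \<open>p ^ k\<close> at \<open>q\<close>.\<close>

lemma lagrange_poly_nsets_le:
  assumes "finite W" "\<And>i. i \<in> W \<Longrightarrow> 0 \<le> x i"
  shows "lagrange_poly ([W]\<^bsup>k\<^esup>) x \<le> real (card W choose k) * (sum x W / real (card W)) ^ k"
  using assms
proof (induction W arbitrary: k rule: finite_induct)
  case empty
  show ?case
    by (cases k) (auto simp: lagrange_poly_def nsets_eq_empty)
next
  case (insert v W)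
  show ?case
  proof (cases k)
    case 0
    then show ?thesis using insert by (simp add: lagrange_poly_def)
  next
    case (Suc j)
    define n where "n = card W"
    define q where "q = sum x W / real n"
    define p where "p = sum x (insert v W) / real (Suc n)"
    have nn: "0 \<le> x v" "0 \<le> sum x W"
      using insert.prems by (auto intro: sum_nonneg)
    \<comment> \<open>For empty \<open>W\<close> division by zero makes \<open>q = 0\<close>, so
      \<open>n q = sum x W\<close> still holds.\<close>
    have q: "0 \<le> q" "real n * q = sum x W"
      using nn insert.hyps by (auto simp: q_def n_def)
    have p: "0 \<le> p" "real (Suc n) * p = real n * q + x v"
      using nn insert.hyps by (auto simp: p_def q(2))
    \<comment> \<open>Everything is expressed through \<open>A\<close>: \<open>b1\<close> absorbs,
      \<open>b2\<close> is Pascal's rule, and \<open>x v = (n + 1) p - n q\<close>. The two terms of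
      the recursion then combine to \<open>A\<close> times the tangent line at
      \<open>q\<close>.\<close>
    define A where "A = real (Suc n choose Suc j)"
    have b1: "real (Suc n) * real (n choose j) = A * real (Suc j)"
      unfolding A_def by (metis Suc_times_binomial_eq of_nat_mult)
    have b2: "real (n choose Suc j) = A - real (n choose j)"
      by (simp add: A_def)
    have "real (Suc n) * (real (n choose Suc j) * q ^ Suc j + x v * (real (n choose j) * q ^ j))
      = real (Suc n) * A * q ^ Suc j - (real (Suc n) * real (n choose j)) * q ^ Suc j
        + (real (Suc n) * real (n choose j)) * (x v * q ^ j)"
      unfolding b2 by (simp add: algebra_simps)
    also have "\<dots> = real (Suc n) * A * q ^ Suc j - (real (Suc n) * real (n choose j)) * q ^ Suc j
        + (real (Suc n) * real (n choose j)) * ((real (Suc n) * p - real n * q) * q ^ j)"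
      using p by simp
    also have "\<dots> = real (Suc n) * (A * (q ^ Suc j + real (Suc j) * q ^ j * (p - q)))"
      unfolding b1 by (simp add: algebra_simps)
    finally have "real (n choose Suc j) * q ^ Suc j + x v * (real (n choose j) * q ^ j)
        = A * (q ^ Suc j + real (Suc j) * q ^ j * (p - q))"
      by (simp del: of_nat_Suc binomial_Suc_Suc)
    also have "\<dots> \<le> A * p ^ Suc j"
      using power_Suc_ge_tangent[OF p(1) q(1)] by (intro mult_left_mono) (auto simp: A_def)
    finally have *: "real (n choose Suc j) * q ^ Suc j + x v * (real (n choose j) * q ^ j)
        \<le> A * p ^ Suc j" .
    have "lagrange_poly ([insert v W]\<^bsup>k\<^esup>) x
        = lagrange_poly ([W]\<^bsup>Suc j\<^esup>) x + x v * lagrange_poly ([W]\<^bsup>j\<^esup>) x"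
      using lagrange_poly_nsets_insert[OF insert.hyps] Suc by simp
    also have "\<dots> \<le> real (n choose Suc j) * q ^ Suc j + x v * (real (n choose j) * q ^ j)"
      using insert.IH[of "Suc j"] insert.IH[of j] insert.prems nn unfolding n_def q_def
      by (intro add_mono mult_left_mono) simp_all
    also note *
    finally show ?thesis
      using insert.hyps Suc by (simp add: A_def p_def n_def del: binomial_Suc_Suc)
  qed
qed

section \<open>Clique values and the Lagrange condition at an optimum\<close>

text \<open>With \<open>a = 1 / n\<close>, passing from \<open>n\<close> to \<open>n - 1\<close>
  multiplies the binomial by \<open>1 - r a\<close> and the power by \<open>(1 - a)^r\<close>.
  Bernoulli for exponent \<open>r - 1\<close>, multiplied by \<open>1 - a\<close>, leaves the
  surplus \<open>(r - 1) a^2\<close>, hence strictness.\<close>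

lemma clique_value_strict_mono:
  assumes "2 \<le> r" "r \<le> n"
  shows "real (n - 1 choose r) / real (n - 1) ^ r < real (n choose r) / real n ^ r"
proof -
  define a where "a = 1 / real n"
  have a: "0 < a" "a \<le> 1" "a < 1" using assms by (auto simp: a_def)
  obtain s where s: "r = Suc s" "s \<ge> 1" using assms(1) by (cases r) auto
  have "1 - real s * a \<le> (1 - a) ^ s"
    using Bernoulli_inequality[of "-a" s] a by simp
  then have "(1 - a) * (1 - real s * a) \<le> (1 - a) ^ r"
    using a s by simp
  moreover have "(1 - a) * (1 - real s * a) = 1 - real r * a + real s * a\<^sup>2"
    by (simp add: s algebra_simps power2_eq_square)
  moreover have "0 < real s * a\<^sup>2" using s a by simp
  ultimately have "1 - real r * a < (1 - a) ^ r" by linarith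
  then have "real n ^ r * (1 - real r * a) < real n ^ r * (1 - a) ^ r"
    using assms by simp
  also have "\<dots> = real (n - 1) ^ r"
    using assms by (simp add: a_def power_mult_distrib[symmetric] algebra_simps of_nat_diff)
  finally have main: "real n ^ r * (1 - real r * a) < real (n - 1) ^ r" .
  have bin: "real (n - 1 choose r) = real (n choose r) * (1 - real r * a)"
  proof -
    have "n * (n - 1 choose r) = (n - r) * (n choose r)"
      using binomial_absorb_comp[of n r] by simp
    then have "real n * real (n - 1 choose r) = (real n - real r) * real (n choose r)"
      using assms by (metis of_nat_diff of_nat_mult)
    then show ?thesis using assms by (simp add: a_def field_simps)
  qed
  have pos: "0 < real (n choose r)" "0 < real n ^ r" "0 < real (n - 1) ^ r"
    using assms by auto
  have "real (n choose r) * (real n ^ r * (1 - real r * a)) < real (n choose r) * real (n - 1) ^ r"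
    using main pos by (intro mult_strict_left_mono)
  then show ?thesis unfolding bin using pos by (simp add: field_simps)
qed

text \<open>The uniform weighting is the witness. All later estimates aim at the closed form on the
  left; this converts it into the Lagrangian at the end.\<close>

lemma nsets_clique_value_le_lagrangian:
  assumes "0 < n"
  shows "real (n choose r) / real n ^ r \<le> lagrangian {1..n} ([{1..n}]\<^bsup>r\<^esup>)"
proof -
  have "r_graph r {1..n} ([{1..n}]\<^bsup>r\<^esup>)" by (simp add: r_graph_def)
  then obtain x where x: "lagrangian {1..n} ([{1..n}]\<^bsup>r\<^esup>) = lagrange_poly ([{1..n}]\<^bsup>r\<^esup>) x"
      "\<And>y. y \<in> weight_simplex {1..n} \<Longrightarrow>
        lagrange_poly ([{1..n}]\<^bsup>r\<^esup>) y \<le> lagrange_poly ([{1..n}]\<^bsup>r\<^esup>) x"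
    using lagrangian_attained[of r "{1..n}"] assms by fastforce
  have "lagrange_poly ([{1..n}]\<^bsup>r\<^esup>) (\<lambda>_. 1 / real n)
      = (\<Sum>e\<in>[{1..n}]\<^bsup>r\<^esup>. (1 / real n) ^ r)"
    unfolding lagrange_poly_def by (rule sum.cong) (auto simp: nsets_def)
  also have "\<dots> = real (n choose r) / real n ^ r"
    by (simp add: power_one_over)
  finally show ?thesis
    using x(1) x(2)[of "\<lambda>_. 1 / real n"] assms by (simp add: weight_simplex_def)
qed

text \<open>The Lagrange multiplier condition, read off from the one-parameter family of weightings that
  assigns \<open>s\<close> to \<open>v\<close> and rescales all other weights.\<close>

lemma optimal_link_eq:
  assumes G: "r_graph r V E" and "0 < r" and v: "v \<in> V"
    and x: "x \<in> weight_simplex V" and xv: "0 < x v" "x v < 1"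
    and max: "\<And>y. y \<in> weight_simplex V \<Longrightarrow> lagrange_poly E y \<le> lagrange_poly E x"
  shows "lagrange_poly ((\<lambda>e. e - {v}) ` {e \<in> E. v \<in> e}) x = real r * lagrange_poly E x"
proof -
  have fin: "finite V" using G by (simp add: r_graph_def)
  have E: "e \<subseteq> V" "finite e" "card e = r" if "e \<in> E" for e
    using G that by (auto simp: r_graph_def nsets_def)
  have finE: "finite E"
    using G fin by (auto simp: r_graph_def intro: finite_subset finite_imp_finite_nsets)
  \<comment> \<open>\<open>c s\<close> is the rescaling that keeps the total weight 1;
    \<open>A\<close> collects the edges avoiding \<open>v\<close>, and \<open>B\<close> is the value
    of the link of \<open>v\<close>.\<close>
  define c where "c s = (1 - s) / (1 - x v)" for s
  define y where "y s = (\<lambda>i. if i = v then s else c s * x i)" for s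
  define A where "A = (\<Sum>e\<in>{e \<in> E. v \<notin> e}. \<Prod>i\<in>e. x i)"
  define B where "B = (\<Sum>e\<in>{e \<in> E. v \<in> e}. \<Prod>i\<in>e - {v}. x i)"
  have link: "lagrange_poly ((\<lambda>e. e - {v}) ` {e \<in> E. v \<in> e}) x = B"
  proof -
    have "inj_on (\<lambda>e. e - {v}) {e \<in> E. v \<in> e}" by (rule inj_onI) blast
    then show ?thesis unfolding lagrange_poly_def B_def by (simp add: sum.reindex)
  qed
  have y_poly: "lagrange_poly E (y s) = c s ^ r * A + s * c s ^ (r - 1) * B" for s
  proof -
    have "lagrange_poly E (y s) = (\<Sum>e\<in>{e \<in> E. v \<notin> e}. \<Prod>i\<in>e. y s i)
        + (\<Sum>e\<in>{e \<in> E. v \<in> e}. \<Prod>i\<in>e. y s i)"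
      unfolding lagrange_poly_def using finE
      by (subst sum.union_disjoint[symmetric]) (auto intro: sum.cong)
    also have "(\<Sum>e\<in>{e \<in> E. v \<notin> e}. \<Prod>i\<in>e. y s i) = c s ^ r * A"
      unfolding A_def sum_distrib_left
    proof (rule sum.cong)
      fix e assume e: "e \<in> {e \<in> E. v \<notin> e}"
      have "(\<Prod>i\<in>e. y s i) = (\<Prod>i\<in>e. c s * x i)"
        by (rule prod.cong) (use e in \<open>auto simp: y_def\<close>)
      then show "(\<Prod>i\<in>e. y s i) = c s ^ r * (\<Prod>i\<in>e. x i)"
        using e E by (simp add: prod.distrib)
    qed simp
    also have "(\<Sum>e\<in>{e \<in> E. v \<in> e}. \<Prod>i\<in>e. y s i) = s * c s ^ (r - 1) * B"
      unfolding B_def sum_distrib_left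
    proof (rule sum.cong)
      fix e assume e: "e \<in> {e \<in> E. v \<in> e}"
      have "(\<Prod>i\<in>e. y s i) = y s v * (\<Prod>i\<in>e - {v}. y s i)"
        using e E by (intro prod.remove) auto
      also have "(\<Prod>i\<in>e - {v}. y s i) = (\<Prod>i\<in>e - {v}. c s * x i)"
        by (rule prod.cong) (use e in \<open>auto simp: y_def\<close>)
      finally show "(\<Prod>i\<in>e. y s i) = s * c s ^ (r - 1) * (\<Prod>i\<in>e - {v}. x i)"
        using e E by (simp add: prod.distrib y_def)
    qed simp
    finally show ?thesis .
  qed
  have cx: "c (x v) = 1" using xv by (simp add: c_def)
  then have yx: "y (x v) = x" by (auto simp: y_def)
  have sumV: "sum x (V - {v}) = 1 - x v"
    using x v fin by (simp add: weight_simplex_def sum_diff1)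
  have y_simplex: "y s \<in> weight_simplex V" if s: "0 \<le> s" "s \<le> 1" for s
  proof -
    have "sum (y s) V = y s v + sum (y s) (V - {v})"
      using fin v by (rule sum.remove)
    also have "sum (y s) (V - {v}) = c s * sum x (V - {v})"
      unfolding sum_distrib_left by (rule sum.cong) (auto simp: y_def)
    finally have "sum (y s) V = 1"
      using xv by (simp add: sumV c_def y_def)
    moreover have "0 \<le> c s" using s xv by (simp add: c_def)
    ultimately show ?thesis
      using x s by (auto simp: weight_simplex_def y_def)
  qed
  define f where "f s = c s ^ r * A + s * c s ^ (r - 1) * B" for s
  define d where "d = 1 / (1 - x v)"
  have d: "d * (1 - x v) = 1" using xv by (simp add: d_def)
  define D where "D = B - d * (real r * A + x v * real (r - 1) * B)"
  have dc: "(c has_real_derivative - d) (at s)" for s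
  proof -
    have "((\<lambda>s. 1 - s) has_real_derivative - 1) (at s)"
      by (auto intro!: derivative_eq_intros)
    from DERIV_cdivide[OF this, of "1 - x v"] show ?thesis
      by (simp add: c_def[abs_def] d_def)
  qed
  have "(f has_real_derivative D) (at (x v))"
    unfolding f_def by (rule derivative_eq_intros dc refl)+ (simp add: cx D_def algebra_simps)
  \<comment> \<open>The radius keeps \<open>s\<close> in the unit interval, so \<open>y s\<close>
    stays in the simplex and \<open>x v\<close> is an interior local maximum of
    \<open>f\<close>.\<close>
  moreover have "f s \<le> f (x v)" if "\<bar>x v - s\<bar> < min (x v) (1 - x v)" for s
  proof -
    have "0 \<le> s" "s \<le> 1" using that by linarith+
    then have "lagrange_poly E (y s) \<le> lagrange_poly E (y (x v))"
      using max[OF y_simplex] yx by simp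
    then show ?thesis unfolding f_def y_poly .
  qed
  ultimately have "D = 0"
    using xv by (intro DERIV_local_max[of f D "x v" "min (x v) (1 - x v)"]) auto
  then have "B * (1 - x v) = (d * (1 - x v)) * (real r * A + x v * real (r - 1) * B)"
    by (simp add: D_def)
  then have "B * (1 - x v) = real r * A + x v * real (r - 1) * B"
    unfolding d by simp
  then have "B = real r * (A + x v * B)"
    using \<open>0 < r\<close> by (simp add: of_nat_diff Suc_leI algebra_simps)
  moreover have "lagrange_poly E x = A + x v * B"
    using y_poly[of "x v"] by (simp add: cx yx)
  ultimately show ?thesis using link by simp
qed

section \<open>Counting edges, weighing non-edges and merging two vertices\<close>

text \<open>Union bound: each such edge is a \<open>k\<close>-subset \<open>T\<close> of
  \<open>B\<close> joined with \<open>r - k\<close> further vertices. Edges meeting \<open>B\<close>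
  in more than \<open>k\<close> vertices are counted several times.\<close>

lemma card_nsets_meeting_le:
  assumes "finite V" "B \<subseteq> V" "k \<le> r"
  shows "card {e \<in> [V]\<^bsup>r\<^esup>. k \<le> card (e \<inter> B)} \<le> (card B choose k) * (card V - k choose (r - k))"
proof -
  have finB: "finite B" using assms finite_subset by blast
  have sub: "{e \<in> [V]\<^bsup>r\<^esup>. k \<le> card (e \<inter> B)}
      \<subseteq> (\<Union>T\<in>[B]\<^bsup>k\<^esup>. (\<union>) T ` [V - T]\<^bsup>(r - k)\<^esup>)"
  proof
    fix e assume "e \<in> {e \<in> [V]\<^bsup>r\<^esup>. k \<le> card (e \<inter> B)}"
    then have e: "e \<subseteq> V" "finite e" "card e = r" "k \<le> card (e \<inter> B)"
      by (auto simp: nsets_def)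
    then obtain T where T: "T \<subseteq> e \<inter> B" "card T = k" "finite T"
      using obtain_subset_with_card_n by metis
    then have "T \<in> [B]\<^bsup>k\<^esup>" "e - T \<in> [V - T]\<^bsup>(r - k)\<^esup>" "e = T \<union> (e - T)"
      using e by (auto simp: nsets_def card_Diff_subset)
    then show "e \<in> (\<Union>T\<in>[B]\<^bsup>k\<^esup>. (\<union>) T ` [V - T]\<^bsup>(r - k)\<^esup>)" by blast
  qed
  have "card {e \<in> [V]\<^bsup>r\<^esup>. k \<le> card (e \<inter> B)}
      \<le> card (\<Union>T\<in>[B]\<^bsup>k\<^esup>. (\<union>) T ` [V - T]\<^bsup>(r - k)\<^esup>)"
    using assms(1) finB
    by (intro card_mono[OF _ sub]) (auto simp: finite_imp_finite_nsets)
  also have "\<dots> \<le> (\<Sum>T\<in>[B]\<^bsup>k\<^esup>. card ((\<union>) T ` [V - T]\<^bsup>(r - k)\<^esup>))"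
    using finB by (intro card_UN_le) (simp add: finite_imp_finite_nsets)
  also have "\<dots> \<le> (\<Sum>T\<in>[B]\<^bsup>k\<^esup>. card V - k choose (r - k))"
  proof (rule sum_mono)
    fix T assume T: "T \<in> [B]\<^bsup>k\<^esup>"
    have "card ((\<union>) T ` [V - T]\<^bsup>(r - k)\<^esup>) \<le> card ([V - T]\<^bsup>(r - k)\<^esup>)"
      using assms(1) by (intro card_image_le) (simp add: finite_imp_finite_nsets)
    also have "\<dots> = card V - k choose (r - k)"
      using T assms(2) by (subst card_nsets) (auto simp: nsets_def card_Diff_subset)
    finally show "card ((\<union>) T ` [V - T]\<^bsup>(r - k)\<^esup>) \<le> card V - k choose (r - k)" .
  qed
  finally show ?thesis by simp
qed

text \<open>Split off a pair \<open>P\<close> of vertices of \<open>e\<close> that contains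
  \<open>e \<inter> B\<close>. The pair contributes at least \<open>x a * x b\<close>, and every
  remaining vertex lies outside \<open>B\<close> and contributes at least \<open>h\<close>.\<close>

lemma prod_ge_two_smallest:
  fixes x :: "'a \<Rightarrow> real"
  assumes e: "finite e" "2 \<le> card e" "card (e \<inter> B) \<le> 2"
    and h: "0 \<le> h" "\<And>i. i \<in> e - B \<Longrightarrow> h \<le> x i"
    and a: "0 \<le> x a" "x a \<le> x b" "\<And>i. i \<in> e \<Longrightarrow> x a \<le> x i"
      "\<And>i. i \<in> e \<Longrightarrow> i \<noteq> a \<Longrightarrow> x b \<le> x i"
  shows "x a * x b * h ^ (card e - 2) \<le> (\<Prod>i\<in>e. x i)"
proof -
  have nonneg: "0 \<le> x i" if "i \<in> e" for i
    using a(1) a(3)[OF that] by linarith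
  obtain P where P: "e \<inter> B \<subseteq> P" "P \<subseteq> e" "card P = 2"
    using exists_subset_between[of "e \<inter> B" 2 e] e by auto
  \<comment> \<open>The pair is ordered so that only \<open>p\<close> can be \<open>a\<close>; hence
    \<open>x a <= x p\<close> and \<open>x b <= x q\<close>.\<close>
  then obtain p q where pq: "P = {p, q}" "p \<noteq> q" "q \<noteq> a"
    by (metis card_2_iff insert_commute)
  have "x a * x b \<le> x p * x q"
    using a pq P by (intro mult_mono) (auto intro: nonneg)
  then have "x a * x b \<le> (\<Prod>i\<in>P. x i)" using pq by simp
  moreover have "h ^ (card e - 2) \<le> (\<Prod>i\<in>e - P. x i)"
  proof -
    have "h ^ (card e - 2) = (\<Prod>i\<in>e - P. h)"
      using P e by (simp add: card_Diff_subset finite_subset)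
    also have "\<dots> \<le> (\<Prod>i\<in>e - P. x i)"
      using h P by (intro prod_mono) auto
    finally show ?thesis .
  qed
  ultimately have "x a * x b * h ^ (card e - 2) \<le> (\<Prod>i\<in>P. x i) * (\<Prod>i\<in>e - P. x i)"
    using h P by (intro mult_mono prod_nonneg) (auto intro: nonneg)
  also have "\<dots> = (\<Prod>i\<in>e. x i)"
    using prod.subset_diff[OF P(2) e(1), of x] by (simp add: mult.commute)
  finally show ?thesis .
qed

text \<open>Replacing \<open>a\<close> and \<open>b\<close> by a single vertex of weight \<open>x a + x b\<close> only loses the edges that
  contain both.\<close>

lemma lagrange_poly_nsets_merge_le:
  assumes "finite V" "a \<in> V" "b \<in> V" "a \<noteq> b" "x \<in> weight_simplex V" "2 \<le> r"
  shows "lagrange_poly ([V]\<^bsup>r\<^esup>) x - x a * x b * lagrange_poly ([V - {a, b}]\<^bsup>(r - 2)\<^esup>) x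
    \<le> real (card V - 1 choose r) / real (card V - 1) ^ r"
proof -
  define W where "W = V - {a, b}"
  obtain k where k: "r = Suc (Suc k)"
    using assms(6) by (metis add_2_eq_Suc le_Suc_ex)
  have W: "finite W" "a \<notin> W" "b \<notin> insert a W" "V = insert b (insert a W)" "b \<notin> W"
    using assms by (auto simp: W_def)
  have nonneg: "\<And>i. i \<in> V \<Longrightarrow> 0 \<le> x i" and "sum x V = 1"
    using assms by (auto simp: weight_simplex_def)
  then have sum1: "x b + (x a + sum x W) = 1" using W by simp
  define y where "y = x(a := x a + x b)"
  have y_eq: "lagrange_poly ([W]\<^bsup>j\<^esup>) y = lagrange_poly ([W]\<^bsup>j\<^esup>) x" for j
    unfolding lagrange_poly_def y_def
    by (intro sum.cong prod.cong refl) (use W in \<open>auto simp: nsets_def\<close>)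
  have "sum y W = sum x W" unfolding y_def by (rule sum.cong) (use W in auto)
  then have sumy: "sum y (insert a W) = 1"
    using W sum1 by (simp add: y_def)
  have nonneg_y: "\<And>i. i \<in> insert a W \<Longrightarrow> 0 \<le> y i"
    using nonneg W(4) by (auto simp: y_def)
  \<comment> \<open>Expanding over \<open>a\<close> and \<open>b\<close>, the polynomial of
    \<open>V\<close> has a constant term, a term with factor \<open>x a + x b\<close> and one with
    factor \<open>x a * x b\<close>. The merged weighting reproduces the first two.\<close>
  have "lagrange_poly ([insert a W]\<^bsup>r\<^esup>) y
      = lagrange_poly ([W]\<^bsup>Suc (Suc k)\<^esup>) x + (x a + x b) * lagrange_poly ([W]\<^bsup>Suc k\<^esup>) x"
    using lagrange_poly_nsets_insert[OF W(1,2)] by (simp add: k y_eq) (simp add: y_def)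
  moreover have "lagrange_poly ([V]\<^bsup>r\<^esup>) x = lagrange_poly ([W]\<^bsup>Suc (Suc k)\<^esup>) x
      + (x a + x b) * lagrange_poly ([W]\<^bsup>Suc k\<^esup>) x + x a * x b * lagrange_poly ([W]\<^bsup>k\<^esup>) x"
    unfolding W(4) k lagrange_poly_nsets_insert[OF finite.insertI[OF W(1)] W(3)]
      lagrange_poly_nsets_insert[OF W(1,2)]
    by (simp add: algebra_simps)
  moreover have "lagrange_poly ([insert a W]\<^bsup>r\<^esup>) y
      \<le> real (card (insert a W) choose r) * (1 / real (card (insert a W))) ^ r"
    using lagrange_poly_nsets_le[of "insert a W" y r] W(1) nonneg_y by (simp only: sumy finite_insert)
  moreover have "card (insert a W) = card V - 1" using W by simp
  ultimately show ?thesis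
    by (simp add: k W_def power_one_over)
qed

section \<open>Upper bound on the weights of an optimal weighting\<close>

text \<open>Let \<open>n = card V - 1\<close> and \<open>s = r - 1\<close>. The link of
  \<open>v\<close> has value at least \<open>r (n choose r) / n^r\<close>, and by Maclaurin at most
  \<open>(n choose s) ((1 - x v) / n)^s\<close>. This gives \<open>n - s <= n (1 - x v)^s\<close>,
  which Bernoulli turns into a linear bound on \<open>x v\<close>.\<close>

lemma optimal_weight_le:
  assumes G: "r_graph r V E" and r: "2 \<le> r" "r < card V" and v: "v \<in> V"
    and x: "x \<in> weight_simplex V" and xv: "0 < x v" "x v < 1"
    and max: "\<And>y. y \<in> weight_simplex V \<Longrightarrow> lagrange_poly E y \<le> lagrange_poly E x"
    and large: "real (card V - 1 choose r) / real (card V - 1) ^ r \<le> lagrange_poly E x"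
  shows "x v \<le> 1 / real (card V - r)"
proof -
  have fin: "finite V" using G by (simp add: r_graph_def)
  define W where "W = V - {v}"
  define n where "n = card W"
  have n: "card V = Suc n" "finite W" "r \<le> n" "0 < n"
    using fin v r by (auto simp: n_def W_def)
  obtain s where s: "r = Suc s" "0 < s" using r by (cases r) auto
  have nonneg: "\<And>i. i \<in> W \<Longrightarrow> 0 \<le> x i" and sumW: "sum x W = 1 - x v"
    using x v fin by (auto simp: weight_simplex_def W_def sum_diff1)
  have sub: "(\<lambda>e. e - {v}) ` {e \<in> E. v \<in> e} \<subseteq> [W]\<^bsup>s\<^esup>"
    using G by (auto simp: r_graph_def nsets_def W_def s)
  have "real r * (real (n choose r) / real n ^ r) \<le> real r * lagrange_poly E x"
    using large by (intro mult_left_mono) (auto simp: n)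
  also have "\<dots> = lagrange_poly ((\<lambda>e. e - {v}) ` {e \<in> E. v \<in> e}) x"
    using optimal_link_eq[OF G _ v x xv max] r by simp
  also have "\<dots> \<le> lagrange_poly ([W]\<^bsup>s\<^esup>) x"
    unfolding lagrange_poly_def
    by (rule sum_mono2[OF _ sub])
      (use nonneg n in \<open>auto simp: nsets_def finite_imp_finite_nsets intro!: prod_nonneg\<close>)
  also have "\<dots> \<le> real (n choose s) * ((1 - x v) / real n) ^ s"
    using lagrange_poly_nsets_le[of W x s] nonneg n by (simp add: sumW n_def)
  finally have "real r * (real (n choose r) / real n ^ r) * real n ^ r
      \<le> real (n choose s) * ((1 - x v) / real n) ^ s * real n ^ r"
    by (rule mult_right_mono) simp
  then have "real r * real (n choose r) \<le> real n * real (n choose s) * (1 - x v) ^ s"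
    using n by (simp add: s power_divide mult.commute mult.left_commute)
  moreover have "real r * real (n choose r) = real (n - s) * real (n choose s)"
  proof -
    have "Suc s * (Suc n choose Suc s) = Suc n * (n choose s)"
      by (rule Suc_times_binomial)
    then have "real (Suc s) * (real (n choose s) + real (n choose Suc s)) = real (Suc n) * real (n choose s)"
      by (metis binomial_Suc_Suc of_nat_add of_nat_mult)
    then show ?thesis using n s by (simp add: of_nat_diff algebra_simps)
  qed
  ultimately have "real (n choose s) * real (n - s) \<le> real (n choose s) * (real n * (1 - x v) ^ s)"
    by (simp add: algebra_simps)
  then have 1: "real (n - s) \<le> real n * (1 - x v) ^ s"
    using n s by simp
  \<comment> \<open>Bernoulli is applied to \<open>1 + x v\<close>, giving
    \<open>(1 - x v)^s <= 1 / (1 + s x v)\<close>.\<close>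
  have "(1 - x v) ^ s * (1 + real s * x v) \<le> (1 - x v) ^ s * (1 + x v) ^ s"
    using xv by (intro mult_left_mono Bernoulli_inequality) auto
  also have "\<dots> = (1 - (x v)\<^sup>2) ^ s"
    by (simp add: power_mult_distrib[symmetric] algebra_simps power2_eq_square)
  also have "\<dots> \<le> 1" using xv by (intro power_le_one) (auto simp: power_le_one)
  finally have 2: "(1 - x v) ^ s * (1 + real s * x v) \<le> 1" .
  have "real (n - s) * (1 + real s * x v) \<le> real n * (1 - x v) ^ s * (1 + real s * x v)"
    using 1 xv by (intro mult_right_mono) auto
  also have "\<dots> \<le> real n" using 2 n by (simp add: mult.assoc mult_left_le)
  finally have "real s * (real (n - s) * x v) \<le> real s * 1"
    using n s by (simp add: of_nat_diff algebra_simps)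
  then have "real (n - s) * x v \<le> 1"
    using s by simp
  moreover have "card V - r = n - s" "0 < n - s" using n s by auto
  ultimately show ?thesis by (simp add: field_simps)
qed

section \<open>Numerical estimates for the number of non-edges\<close>

text \<open>Serves to bound \<open>2 r - 1 choose 3\<close> with \<open>q = r - 4\<close>. A step of
  \<open>q\<close> multiplies the left side by at most 4 and the right side by exactly 4.\<close>

lemma odd_product_le_power: "(2 * real q + 7) * (2 * real q + 5) \<le> 48 * (2 ^ q)\<^sup>2"
proof (induction q)
  case (Suc q)
  have "(2 * real (Suc q) + 7) * (2 * real (Suc q) + 5) \<le> 4 * ((2 * real q + 7) * (2 * real q + 5))"
    using zero_le_square[of "real q"] by (simp add: algebra_simps)
  also have "\<dots> \<le> 4 * (48 * (2 ^ q)\<^sup>2)" using Suc by (intro mult_left_mono) auto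
  also have "\<dots> = 48 * (2 ^ Suc q)\<^sup>2" by (simp add: power2_eq_square)
  finally show ?case .
qed simp

text \<open>The right side will bound the non-edges from below. On the left, the first term is the
  number of heavy non-edges that pays for the merging, and the second bounds the edges with at least
  three of at most \<open>2 r - 1\<close> light vertices. Hypothesis \<open>t\<close> makes the
  vertex number exponential in \<open>r\<close>; then both terms are at most \<open>4 z N\<close>,
  and \<open>8 z N <= c (N - 1)\<close>.\<close>

lemma missing_edges_bound:
  fixes r t :: nat and c :: real
  assumes r: "4 \<le> r" "r < t"
    and c: "c = (2 * real r - 6) * 2 ^ (r - 1) + 2 ^ (r - 3) + (real r - 4) * (2 * real r - 7) - 1"
    and t: "c * (real (t - 2 choose (r - 2)) - 1) \<le> real (t - 2 choose (r - 1))"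
  shows "2 ^ (r - 2) * real (t - 2 choose (r - 2))
      + real (2 * r - 1 choose 3) * real (t - 3 choose (r - 3))
    < (c + 1) * real (t - 2 choose (r - 2)) - c"
proof -
  obtain q where q: "r = q + 4" using r by (metis add.commute le_Suc_ex)
  obtain n where n: "t = Suc (Suc (Suc n))" "q + 2 \<le> n"
    using r by (intro that[of "t - 3"]) (auto simp: q)
  define z where "z = (2::real) ^ q"
  have z: "1 \<le> z" by (simp add: z_def)
  define N M P where "N = real (t - 2 choose (r - 2))"
    and "M = real (t - 3 choose (r - 3))" and "P = real (t - 2 choose (r - 1))"
  define K where "K = real (2 * r - 1 choose 3)"
  have [simp]: "r - 2 = Suc (Suc q)" "r - 3 = Suc q" "r - 1 = Suc (Suc (Suc q))"
    "t - 2 = Suc n" "t - 3 = n"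
    using q n by auto
  have c': "c = (2 * real q + 2) * (8 * z) + 2 * z + real q * (2 * real q + 1) - 1"
    unfolding c q by (simp add: z_def algebra_simps power_add)
  have "c - 8 * (real q + 2) * z = 8 * (real q * z) + (2 * z - 1) + real q * (2 * real q + 1)"
    by (simp add: c' algebra_simps)
  also have "\<dots> \<ge> 0" using z by (intro add_nonneg_nonneg) auto
  finally have c_ge: "8 * (real q + 2) * z \<le> c" by simp
  have c_nonneg: "0 \<le> c" by (rule order_trans[OF _ c_ge]) (use z in simp)
  have NM: "(real q + 2) * N = (real n + 1) * M"
  proof -
    have "Suc (Suc q) * (Suc n choose Suc (Suc q)) = Suc n * (n choose Suc q)"
      by (rule Suc_times_binomial)
    then have "real (Suc (Suc q)) * real (Suc n choose Suc (Suc q)) = real (Suc n) * real (n choose Suc q)"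
      by (metis of_nat_mult)
    then show ?thesis by (simp add: N_def M_def algebra_simps del: binomial_Suc_Suc)
  qed
  have NP: "(real q + 3) * P = (real n - real q - 1) * N"
  proof -
    have "Suc (Suc (Suc q)) * (Suc (Suc n) choose Suc (Suc (Suc q))) = Suc (Suc n) * (Suc n choose Suc (Suc q))"
      by (rule Suc_times_binomial)
    then have "real (Suc (Suc (Suc q))) * (real (Suc n choose Suc (Suc q)) + real (Suc n choose Suc (Suc (Suc q))))
        = real (Suc (Suc n)) * real (Suc n choose Suc (Suc q))"
      by (metis binomial_Suc_Suc of_nat_add of_nat_mult)
    then show ?thesis by (simp add: N_def P_def algebra_simps del: binomial_Suc_Suc One_nat_def)
  qed
  have M: "1 \<le> M" using n by (simp add: M_def Suc_leI)
  \<comment> \<open>\<open>M < N\<close> and integrality give \<open>N >= 2\<close>, so that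
    \<open>N - 1 >= N / 2\<close>.\<close>
  have "(real q + 2) * M < (real q + 2) * N"
    unfolding NM using M n by (intro mult_strict_right_mono) auto
  then have "M < N" by (rule mult_left_less_imp_less) simp
  then have "1 < N" using M by linarith
  then have N: "2 \<le> N" by (simp add: N_def del: binomial_Suc_Suc)
  have "(8 * (real q + 2) * z) * (N / 2) \<le> c * (N - 1)"
    using c_ge c_nonneg N by (intro mult_mono) auto
  then have cN: "4 * (real q + 2) * z * N \<le> c * (N - 1)" by (simp add: algebra_simps)
  \<comment> \<open>By \<open>NP\<close>, cancelling \<open>N\<close> turns the bound on
    \<open>P\<close> into \<open>t - 2 >= (r - 1) (r - 2) 2^(r - 2)\<close>, stated with
    \<open>n + 1 = t - 2\<close> and \<open>z = 2^(r - 4)\<close>.\<close>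
  have "(real q + 3) * (4 * (real q + 2) * z * N) \<le> (real q + 3) * P"
    using cN t by (intro mult_left_mono) (auto simp: N_def P_def)
  then have "((real q + 3) * (4 * (real q + 2) * z)) * N \<le> (real n - real q - 1) * N"
    unfolding NP by (simp add: mult.assoc)
  then have "(real q + 3) * (4 * (real q + 2) * z) \<le> real n - real q - 1"
    using N by simp
  then have tn: "(real q + 3) * (4 * (real q + 2) * z) \<le> real n + 1" by simp
  have K: "6 * K = (2 * real q + 7) * (2 * real q + 6) * (2 * real q + 5)"
  proof -
    have "6 * (m + 2 choose 3) = (m + 2) * (m + 1) * m" for m :: nat
    proof -
      have "3 * (m + 2 choose 3) = (m + 2) * (m + 1 choose 2)"
        using Suc_times_binomial[of 2 "m + 1"] by (simp add: eval_nat_numeral)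
      moreover have "2 * (m + 1 choose 2) = (m + 1) * m"
        using Suc_times_binomial[of 1 m] by (simp add: eval_nat_numeral)
      ultimately show ?thesis by (metis mult.assoc mult.left_commute mult_2 numeral_Bit0 distrib_right)
    qed
    from this[of "2 * q + 5"] have "6 * (2 * r - 1 choose 3) = (2 * q + 7) * (2 * q + 6) * (2 * q + 5)"
      by (simp add: q ac_simps)
    then have "real 6 * real (2 * r - 1 choose 3) = real ((2 * q + 7) * (2 * q + 6) * (2 * q + 5))"
      by (metis of_nat_mult)
    then show ?thesis by (simp add: K_def)
  qed
  have "6 * K = (2 * real q + 7) * (2 * real q + 5) * (2 * real q + 6)"
    unfolding K by simp
  also have "\<dots> \<le> 48 * z\<^sup>2 * (2 * real q + 6)"
    unfolding z_def by (intro mult_right_mono odd_product_le_power) simp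
  finally have "6 * K \<le> 48 * z\<^sup>2 * (2 * real q + 6)" .
  then have K_le: "K \<le> 4 * z * (4 * z * (real q + 3))"
    by (simp add: power2_eq_square algebra_simps)
  \<comment> \<open>\<open>M\<close> is \<open>(q + 2) / (n + 1)\<close> times \<open>N\<close>, and
    \<open>n + 1\<close> is large enough to outweigh \<open>K <= 16 z^2 (q + 3)\<close>.\<close>
  have "(real n + 1) * (K * M) = K * ((real q + 2) * N)"
    by (simp add: NM)
  also have "\<dots> \<le> (4 * z * (4 * z * (real q + 3))) * ((real q + 2) * N)"
    using K_le N by (intro mult_right_mono) auto
  also have "\<dots> = ((real q + 3) * (4 * (real q + 2) * z)) * (4 * z * N)"
    by (simp add: algebra_simps)
  also have "\<dots> \<le> (real n + 1) * (4 * z * N)"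
    using tn z N by (intro mult_right_mono) auto
  finally have "K * M \<le> 4 * z * N" by simp
  moreover have "8 * z * N \<le> c * (N - 1)"
  proof -
    have "8 * z * N \<le> 4 * (real q + 2) * z * N"
      using z N by (intro mult_right_mono) auto
    then show ?thesis using cN by linarith
  qed
  ultimately have "4 * z * N + K * M \<le> c * (N - 1)" by linarith
  then show ?thesis
    using N unfolding N_def[symmetric] M_def[symmetric] K_def[symmetric]
    by (simp add: z_def algebra_simps)
qed

section \<open>Optimal weightings with and without a zero weight\<close>

text \<open>The other \<open>t - 1\<close> vertices, \<open>t = card V\<close>, miss some
  \<open>r\<close>-set \<open>f\<close>. If \<open>f\<close> has positive weight, it is a strict
  loss against Maclaurin's bound. Otherwise a second weight vanishes, and the clique value on
  \<open>t - 2\<close> vertices is strictly smaller.\<close>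

lemma lagrange_poly_zero_weight_less:
  assumes G: "r_graph r V E" and r: "2 \<le> r" "r < card V"
    and no: "\<not> has_clique r V E (card V - 1)"
    and x: "x \<in> weight_simplex V" and v: "v \<in> V" "x v = 0"
  shows "lagrange_poly E x < real (card V - 1 choose r) / real (card V - 1) ^ r"
proof -
  define W where "W = V - {v}"
  define n where "n = card W"
  have fin: "finite V" using G by (simp add: r_graph_def)
  have finW: "finite W" and n: "card V - 1 = n" "r \<le> n"
    using fin v r by (auto simp: W_def n_def)
  have nonneg: "\<And>i. i \<in> W \<Longrightarrow> 0 \<le> x i" and sumW: "sum x W = 1"
    using x v fin by (auto simp: weight_simplex_def W_def sum_diff1)
  have "\<not> is_clique r V E W"
    using no n by (auto simp: has_clique_def n_def)
  then obtain f where f: "f \<in> [W]\<^bsup>r\<^esup>" "f \<notin> E"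
    by (auto simp: is_clique_def W_def)
  have finS: "finite ([W]\<^bsup>r\<^esup>)" using finW by (simp add: finite_imp_finite_nsets)
  have prod_nn: "0 \<le> (\<Prod>i\<in>e. x i)" if "e \<in> [W]\<^bsup>r\<^esup>" for e
    using that nonneg by (auto simp: nsets_def intro!: prod_nonneg)
  have E: "finite e" "e \<in> [V]\<^bsup>r\<^esup>" if "e \<in> E" for e
    using G that by (auto simp: r_graph_def nsets_def)
  have finE: "finite E"
    using G fin by (auto simp: r_graph_def intro: finite_subset finite_imp_finite_nsets)
  have "lagrange_poly E x = (\<Sum>e\<in>{e \<in> E. v \<notin> e}. \<Prod>i\<in>e. x i)"
    unfolding lagrange_poly_def
    by (rule sum.mono_neutral_right) (use v E finE in auto)
  also have "\<dots> \<le> (\<Sum>e\<in>[W]\<^bsup>r\<^esup> - {f}. \<Prod>i\<in>e. x i)"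
    using f E finS prod_nn by (intro sum_mono2) (auto simp: W_def nsets_def)
  also have "\<dots> = lagrange_poly ([W]\<^bsup>r\<^esup>) x - (\<Prod>i\<in>f. x i)"
    using f finS by (simp add: lagrange_poly_def sum_diff1)
  finally have le: "lagrange_poly E x \<le> lagrange_poly ([W]\<^bsup>r\<^esup>) x - (\<Prod>i\<in>f. x i)" .
  show ?thesis
  proof (cases "(\<Prod>i\<in>f. x i) = 0")
    case False
    then have "0 < (\<Prod>i\<in>f. x i)" using prod_nn[OF f(1)] by simp
    moreover have "lagrange_poly ([W]\<^bsup>r\<^esup>) x \<le> real (n choose r) / real n ^ r"
      using lagrange_poly_nsets_le[of W x r] finW nonneg by (simp add: sumW n_def power_one_over)
    ultimately show ?thesis using le n by simp
  next
    case True
    then obtain u where u: "u \<in> f" "x u = 0" "u \<in> W"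
      using f by (auto simp: nsets_def)
    define U where "U = W - {u}"
    have U: "finite U" "u \<notin> U" "W = insert u U" "card U = n - 1" "sum x U = 1"
      using u finW sumW by (auto simp: U_def n_def sum_diff1)
    obtain s where s: "r = Suc s" using r by (cases r) auto
    have "lagrange_poly ([W]\<^bsup>r\<^esup>) x = lagrange_poly ([U]\<^bsup>r\<^esup>) x"
      unfolding U(3) s lagrange_poly_nsets_insert[OF U(1,2)] using u by simp
    also have "\<dots> \<le> real (n - 1 choose r) / real (n - 1) ^ r"
      using lagrange_poly_nsets_le[OF U(1), of x r] nonneg U
      by (simp add: power_one_over)
    also have "\<dots> < real (n choose r) / real n ^ r"
      using clique_value_strict_mono r n by blast
    finally show ?thesis using le True n by simp
  qed
qed

text \<open>By contradiction, because the weight bound \<open>u\<close> comes from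
  \<open>large\<close>. Assumption \<open>missing\<close> leaves enough non-edges after discarding
  those with three or more vertices in the light set \<open>B\<close>.\<close>

lemma lagrange_poly_optimal_less:
  assumes G: "r_graph r V E" and r: "4 \<le> r" "r < card V"
    and x: "x \<in> weight_simplex V" and pos: "\<And>i. i \<in> V \<Longrightarrow> 0 < x i"
    and max: "\<And>y. y \<in> weight_simplex V \<Longrightarrow> lagrange_poly E y \<le> lagrange_poly E x"
    and missing: "2 ^ (r - 2) * real (card V - 2 choose (r - 2))
      + real (2 * r - 1 choose 3) * real (card V - 3 choose (r - 3)) < real (card ([V]\<^bsup>r\<^esup> - E))"
  shows "lagrange_poly E x < real (card V - 1 choose r) / real (card V - 1) ^ r"
proof (rule ccontr)
  assume "\<not> ?thesis"
  then have large: "real (card V - 1 choose r) / real (card V - 1) ^ r \<le> lagrange_poly E x"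
    by simp
  define t where "t = card V"
  define u where "u = 1 / real (t - r)"
  have u: "0 < u" using r by (simp add: u_def t_def)
  have fin: "finite V" and sumV: "sum x V = 1" and ES: "E \<subseteq> [V]\<^bsup>r\<^esup>"
    using G x by (auto simp: r_graph_def weight_simplex_def)
  have x_le: "x v \<le> u" if v: "v \<in> V" for v
  proof -
    have "card (V - {v}) \<noteq> 0" using v fin r by simp
    then have "V - {v} \<noteq> {}" by (metis card.empty)
    then have "0 < sum x (V - {v})"
      using fin pos by (intro sum_pos) auto
    then have "x v < 1" using sumV v fin by (simp add: sum_diff1)
    then show ?thesis
      using optimal_weight_le[OF G _ r(2) v x pos[OF v] _ max large] r by (simp add: u_def t_def)
  qed
  define B where "B = {i \<in> V. x i < u / 2}"
  have B: "finite B" "B \<subseteq> V" using fin by (auto simp: B_def)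
  have cardB: "card B \<le> 2 * r - 1"
  proof (rule ccontr)
    assume "\<not> ?thesis"
    then have big: "2 * r \<le> card B" by simp
    then have "B \<noteq> {}" using r by auto
    have "real r * u \<le> real (card B) * (u / 2)"
      using big u by simp
    also have "\<dots> = (\<Sum>i\<in>B. u / 2)" by simp
    also have "\<dots> < (\<Sum>i\<in>B. u - x i)"
      by (rule sum_strict_mono) (use B \<open>B \<noteq> {}\<close> in \<open>auto simp: B_def\<close>)
    also have "\<dots> \<le> (\<Sum>i\<in>V. u - x i)"
      using B fin x_le by (intro sum_mono2) auto
    also have "\<dots> = real t * u - 1" by (simp add: sum_subtractf sumV t_def)
    also have "\<dots> = real r * u"
      using r by (simp add: u_def t_def of_nat_diff field_simps)
    finally show False by simp
  qed
  have "\<exists>a. a \<in> V \<and> (\<forall>i\<in>V. x a \<le> x i)"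
    using ex_is_arg_min_if_finite[OF fin, of x] r by (fastforce simp: is_arg_min_linorder)
  then obtain a where a: "a \<in> V" "\<And>i. i \<in> V \<Longrightarrow> x a \<le> x i" by blast
  have "card (V - {a}) \<noteq> 0" using a fin r by simp
  then have "V - {a} \<noteq> {}" by (metis card.empty)
  then have "\<exists>b. b \<in> V - {a} \<and> (\<forall>i\<in>V - {a}. x b \<le> x i)"
    using ex_is_arg_min_if_finite[of "V - {a}" x] fin by (fastforce simp: is_arg_min_linorder)
  then obtain b where b: "b \<in> V" "b \<noteq> a" "\<And>i. i \<in> V \<Longrightarrow> i \<noteq> a \<Longrightarrow> x b \<le> x i" by blast
  define N where "N = real (t - 2 choose (r - 2))"
  define M where "M = [V]\<^bsup>r\<^esup> - E"
  define H where "H = {e \<in> M. card (e \<inter> B) \<le> 2}"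
  \<comment> \<open>A lower bound for the weight of each edge in \<open>H\<close>;
    \<open>2^(r - 2) N w\<close> equals the bound \<open>x a * x b * N * u^(r - 2)\<close> on the
    merging loss.\<close>
  define w where "w = x a * x b * (u / 2) ^ (r - 2)"
  have w: "0 < w" using pos a b u by (simp add: w_def)
  have finV: "finite ([V]\<^bsup>r\<^esup>)" using fin by (simp add: finite_imp_finite_nsets)
  have finM: "finite M" using finV by (simp add: M_def)
  have finH: "finite H" using finM by (simp add: H_def)
  have M: "finite e" "e \<subseteq> V" "card e = r" if "e \<in> M" for e
    using that by (auto simp: M_def nsets_def)
  have "card M \<le> card (H \<union> {e \<in> [V]\<^bsup>r\<^esup>. 3 \<le> card (e \<inter> B)})"
    using finV finH by (intro card_mono) (auto simp: M_def H_def)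
  also have "\<dots> \<le> card H + card {e \<in> [V]\<^bsup>r\<^esup>. 3 \<le> card (e \<inter> B)}"
    by (rule card_Un_le)
  also have "\<dots> \<le> card H + (card B choose 3) * (t - 3 choose (r - 3))"
    using card_nsets_meeting_le[OF fin B(2), of 3 r] r by (simp add: t_def)
  also have "\<dots> \<le> card H + (2 * r - 1 choose 3) * (t - 3 choose (r - 3))"
    using cardB by (intro add_left_mono mult_right_mono binomial_right_mono) auto
  finally have "real (card M) \<le> real (card H + (2 * r - 1 choose 3) * (t - 3 choose (r - 3)))"
    by (rule of_nat_mono)
  then have H: "2 ^ (r - 2) * N < real (card H)"
    using missing by (simp add: M_def N_def t_def)
  have "x a * x b * lagrange_poly ([V - {a, b}]\<^bsup>(r - 2)\<^esup>) x \<le> x a * x b * (N * u ^ (r - 2))"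
  proof (rule mult_left_mono)
    have "lagrange_poly ([V - {a, b}]\<^bsup>(r - 2)\<^esup>) x \<le> (\<Sum>e\<in>[V - {a, b}]\<^bsup>(r - 2)\<^esup>. u ^ (r - 2))"
      unfolding lagrange_poly_def
    proof (rule sum_mono)
      fix e assume e: "e \<in> [V - {a, b}]\<^bsup>(r - 2)\<^esup>"
      then have "(\<Prod>i\<in>e. x i) \<le> (\<Prod>i\<in>e. u)"
        using pos x_le by (intro prod_mono) (auto simp: nsets_def intro: less_imp_le)
      then show "(\<Prod>i\<in>e. x i) \<le> u ^ (r - 2)" using e by (simp add: nsets_def)
    qed
    also have "\<dots> = N * u ^ (r - 2)"
      using a b fin by (simp add: N_def t_def card_Diff_subset numeral_2_eq_2)
    finally show "lagrange_poly ([V - {a, b}]\<^bsup>(r - 2)\<^esup>) x \<le> N * u ^ (r - 2)" .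
  qed (use pos a b in \<open>simp add: less_imp_le\<close>)
  also have "\<dots> = 2 ^ (r - 2) * N * w"
    by (simp add: w_def power_divide)
  also have "\<dots> < real (card H) * w"
    using H w by (rule mult_strict_right_mono)
  also have "\<dots> \<le> (\<Sum>e\<in>H. \<Prod>i\<in>e. x i)"
  proof (rule sum_bounded_below)
    fix e assume "e \<in> H"
    then have e: "e \<in> M" "card (e \<inter> B) \<le> 2" by (auto simp: H_def)
    have V: "i \<in> V" if "i \<in> e" for i using M(2)[OF e(1)] that by blast
    have "x a * x b * (u / 2) ^ (card e - 2) \<le> (\<Prod>i\<in>e. x i)"
    proof (rule prod_ge_two_smallest)
      show "finite e" "2 \<le> card e" using M[OF e(1)] r by auto
      show "card (e \<inter> B) \<le> 2" by (rule e(2))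
      show "u / 2 \<le> x i" if "i \<in> e - B" for i using V that by (force simp: B_def)
      show "0 \<le> x a" using pos[OF a(1)] by simp
    qed (use a b V u in auto)
    then show "w \<le> (\<Prod>i\<in>e. x i)" using M[OF e(1)] by (simp add: w_def)
  qed
  also have "\<dots> \<le> (\<Sum>e\<in>M. \<Prod>i\<in>e. x i)"
    using finM M pos
    by (intro sum_mono2) (auto simp: H_def less_imp_le subset_eq intro!: prod_nonneg)
  finally have "x a * x b * lagrange_poly ([V - {a, b}]\<^bsup>(r - 2)\<^esup>) x
      < (\<Sum>e\<in>M. \<Prod>i\<in>e. x i)" .
  \<comment> \<open>The non-edges outweigh the merging loss, so removing them from the complete
    polynomial leaves less than the clique value on \<open>card V - 1\<close> vertices.\<close>
  moreover have "lagrange_poly ([V]\<^bsup>r\<^esup>) x = (\<Sum>e\<in>M. \<Prod>i\<in>e. x i) + lagrange_poly E x"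
    unfolding lagrange_poly_def M_def by (rule sum.subset_diff[OF ES finV])
  moreover have "lagrange_poly ([V]\<^bsup>r\<^esup>) x
      - x a * x b * lagrange_poly ([V - {a, b}]\<^bsup>(r - 2)\<^esup>) x
      \<le> real (card V - 1 choose r) / real (card V - 1) ^ r"
    using lagrange_poly_nsets_merge_le[OF fin a(1) b(1) b(2)[symmetric] x, of r] r by simp
  ultimately show False using large by linarith
qed

theorem theorem1p10:
  fixes m t r :: nat and V :: "'a set" and E :: "'a set set"
  assumes "r \<ge> 4"
    and "(t - 1) choose r \<le> m"
    and "int m \<le> int ((t - 1) choose r) + int ((t - 2) choose (r - 1))
           - ((2 * int r - 6) * 2 ^ (r - 1) + 2 ^ (r - 3) + (int r - 4) * (2 * int r - 7) - 1)
             * (int ((t - 2) choose (r - 2)) - 1)"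
    and "r_graph r V E"
    and "card V = t"
    and "card E = m"
    and "\<not> has_clique r V E (t - 1)"
  shows "lagrangian V E < lagrangian {1..t - 1} ([{1..t - 1}]\<^bsup>r\<^esup>)"
proof -
  have fin: "finite V" and ES: "E \<subseteq> [V]\<^bsup>r\<^esup>"
    using assms(4) by (auto simp: r_graph_def)
  have rt: "r < t"
  proof (rule ccontr)
    assume "\<not> r < t"
    \<comment> \<open>With fewer than \<open>r\<close> vertices, any \<open>t - 1\<close> vertices
      form a clique vacuously.\<close>
    then have small: "t - 1 < r" using assms(1) by simp
    obtain K where K: "K \<subseteq> V" "card K = t - 1" "finite K"
      using obtain_subset_with_card_n[of "t - 1" V] assms(5) by auto
    then have "[K]\<^bsup>r\<^esup> = {}" using small by (simp add: nsets_eq_empty)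
    then show False using K assms(7) by (auto simp: has_clique_def is_clique_def)
  qed
  then have "V \<noteq> {}" using assms(5) by auto
  then obtain x where x: "x \<in> weight_simplex V" "lagrangian V E = lagrange_poly E x"
      "\<And>y. y \<in> weight_simplex V \<Longrightarrow> lagrange_poly E y \<le> lagrange_poly E x"
    using lagrangian_attained[OF assms(4)] by blast
  have "lagrange_poly E x < real (t - 1 choose r) / real (t - 1) ^ r"
  proof (cases "\<exists>v\<in>V. x v = 0")
    case True
    then show ?thesis
      using lagrange_poly_zero_weight_less[OF assms(4)] x(1) assms(1,5,7) rt by auto
  next
    case False
    then have pos: "\<And>i. i \<in> V \<Longrightarrow> 0 < x i"
      using x(1) by (force simp: weight_simplex_def)
    define c where "c = (2 * real r - 6) * 2 ^ (r - 1) + 2 ^ (r - 3) + (real r - 4) * (2 * real r - 7) - 1"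
    define N where "N = real (t - 2 choose (r - 2))"
    have "real_of_int (int m) \<le> real_of_int (int ((t - 1) choose r) + int ((t - 2) choose (r - 1))
           - ((2 * int r - 6) * 2 ^ (r - 1) + 2 ^ (r - 3) + (int r - 4) * (2 * int r - 7) - 1)
             * (int ((t - 2) choose (r - 2)) - 1))"
      using assms(3) by (simp only: of_int_le_iff)
    then have m_le: "real m \<le> real (t - 1 choose r) + real (t - 2 choose (r - 1)) - c * (N - 1)"
      by (simp add: c_def N_def)
    \<comment> \<open>The two bounds on \<open>m\<close> are compatible only if this holds; it is
      what forces \<open>t\<close> to be large.\<close>
    then have c_le: "c * (N - 1) \<le> real (t - 2 choose (r - 1))"
      using assms(2) by simp
    have "card ([V]\<^bsup>r\<^esup> - E) = (t choose r) - m"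
      using ES fin assms(5,6) by (simp add: card_Diff_subset finite_subset finite_imp_finite_nsets)
    moreover have "m \<le> t choose r"
      using card_mono[OF _ ES] fin assms(5,6) by (simp add: finite_imp_finite_nsets)
    \<comment> \<open>Pascal's rule twice. Subtracting the upper bound on \<open>m\<close> leaves at
      least \<open>N + c (N - 1) = (c + 1) N - c\<close> non-edges.\<close>
    moreover have "t choose r = (t - 1 choose r) + (t - 2 choose (r - 1)) + (t - 2 choose (r - 2))"
    proof -
      obtain s p where "r = Suc (Suc s)" "t = Suc (Suc p)"
        using assms(1) rt by (intro that[of "r - 2" "t - 2"]) auto
      then show ?thesis by simp
    qed
    ultimately have "(c + 1) * N - c \<le> real (card ([V]\<^bsup>r\<^esup> - E))"
      using m_le by (simp add: N_def of_nat_diff algebra_simps)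
    moreover have "2 ^ (r - 2) * N + real (2 * r - 1 choose 3) * real (t - 3 choose (r - 3))
        < (c + 1) * N - c"
      unfolding N_def using missing_edges_bound[OF assms(1) rt c_def] c_le by (simp add: N_def)
    ultimately show ?thesis
      using lagrange_poly_optimal_less[OF assms(4,1) _ x(1) pos x(3)] rt assms(5)
      by (simp add: N_def)
  qed
  also have "\<dots> \<le> lagrangian {1..t - 1} ([{1..t - 1}]\<^bsup>r\<^esup>)"
    using assms(1) rt by (intro nsets_clique_value_le_lagrangian) simp
  finally show ?thesis using x(2) by simp
qed

end
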